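(* For all $1\le p\le\infty$ we have $$C_{1,p}=\left(\sum_{n=1}^\infty\left(\frac1n-\frac1{n+1}\right)^p\right)^{1/p},$$ where for $p=\infty$ the right-hand side is interpreted as $\sup_{n\ge1}\left(\frac1n-\frac1{n+1}\right)=\frac12$. The function $\chi_{\{0\}}$ is an extremizer, i.e. $\|(\mathcal{M}\chi_{\{0\}})'\|_{\ell^p(\mathbb{Z})}=C_{1,p}\|\chi_{\{0\}}'\|_{\ell^p(\mathbb{Z})}$.
   Context: An interval in $\mathbb{Z}$ is a nonempty finite set of consecutive integers. For $f:\mathbb{Z}\to\mathbb{R}$ the discrete uncentered maximal function is $\mathcal{M}f(n)=\sup_{I\ni n}\frac1{|I|}\sum_{i\in I}|f(i)|$, the supremum being over all intervals $I\subset\mathbb{Z}$ containing $n$, with $|I|$ the cardinality of $I$. The discrete derivative is $f'(n)=f(n+1)-f(n)$. For $S\subseteq\mathbb{Z}$, $\chi_S$ is its characteristic function. For $1\le p\le\infty$, $C_{1,p}\in[0,\infty]$ is the smallest number such that $\|(\mathcal{M}\chi_S)'\|_{\ell^p(\mathbb{Z})}\le C_{1,p}\|\chi_S'\|_{\ell^p(\mathbb{Z})}$ for all $S\subseteq\mathbb{Z}$ with $\|\chi_S'\|_{\ell^p(\mathbb{Z})}<\infty$. *)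

theory Defs
  imports "HOL-Analysis.Analysis"
begin

definition int_interval :: "int set \<Rightarrow> bool" where
  "int_interval I \<longleftrightarrow> (\<exists>a b. a \<le> b \<and> I = {a..b})"

(* The supremum is taken in the reals, so it is meaningful only if the averages are bounded;
   this is the case for bounded f, see bdd_above_averages. *)
definition maximal_fun :: "(int \<Rightarrow> real) \<Rightarrow> int \<Rightarrow> real" where
  "maximal_fun f n = (SUP I\<in>{I. int_interval I \<and> n \<in> I}. 1 / real (card I) * (\<Sum>i\<in>I. \<bar>f i\<bar>))"

definition discrete_deriv :: "(int \<Rightarrow> real) \<Rightarrow> int \<Rightarrow> real" where
  "discrete_deriv f n = f (n + 1) - f n"

(* Only used with r > 0. *)
definition ennreal_powr :: "ennreal \<Rightarrow> real \<Rightarrow> ennreal" where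
  "ennreal_powr x r = (if x = \<infinity> then \<infinity> else ennreal (enn2real x powr r))"

definition lp_norm :: "ennreal \<Rightarrow> (int \<Rightarrow> real) \<Rightarrow> ennreal" where
  "lp_norm p f =
     (if p = \<infinity> then (SUP n. ennreal \<bar>f n\<bar>)
      else ennreal_powr (\<Sum>\<^sub>\<infinity>n. ennreal (\<bar>f n\<bar> powr enn2real p)) (1 / enn2real p))"

(* In ennreal, \<infinity> * 0 = 0. *)
definition C1_admissible :: "ennreal \<Rightarrow> ennreal \<Rightarrow> bool" where
  "C1_admissible p C \<longleftrightarrow>
     (\<forall>S. lp_norm p (discrete_deriv (indicator S)) < \<infinity> \<longrightarrow>
        lp_norm p (discrete_deriv (maximal_fun (indicator S)))
          \<le> C * lp_norm p (discrete_deriv (indicator S)))"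

(* The least admissible constant exists, see C1_is_least. *)
definition C1 :: "ennreal \<Rightarrow> ennreal" where
  "C1 p = (LEAST C. C1_admissible p C)"

lemma bdd_above_averages:
  assumes "\<And>i. \<bar>f i\<bar> \<le> (B::real)"
  shows "bdd_above ((\<lambda>I. 1 / real (card I) * (\<Sum>i\<in>I. \<bar>f i\<bar>)) ` {I. int_interval I \<and> n \<in> I})"
proof (rule bdd_aboveI2[where M = B])
  fix I assume "I \<in> {I. int_interval I \<and> n \<in> I}"
  hence I: "finite I" "I \<noteq> {}" by (auto simp: int_interval_def)
  have "(\<Sum>i\<in>I. \<bar>f i\<bar>) \<le> real (card I) * B"
    using sum_bounded_above[of I "\<lambda>i. \<bar>f i\<bar>" B] assms by simp
  moreover have "card I > 0" using I by (simp add: card_gt_0_iff)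
  ultimately show "1 / real (card I) * (\<Sum>i\<in>I. \<bar>f i\<bar>) \<le> B"
    by (simp add: field_simps)
qed

lemma lp_norm_zero: "1 \<le> p \<Longrightarrow> lp_norm p (\<lambda>_. 0) = 0"
  by (auto simp: lp_norm_def ennreal_powr_def)

lemma lp_norm_eq_0D:
  assumes "lp_norm p f = 0"
  shows "f n = 0"
proof (cases "p = \<infinity>")
  case True
  with assms have "ennreal \<bar>f n\<bar> \<le> 0"
    by (metis SUP_upper UNIV_I lp_norm_def)
  thus ?thesis by simp
next
  case False
  let ?g = "\<lambda>n. ennreal (\<bar>f n\<bar> powr enn2real p)"
  have inf0: "infsum ?g UNIV = 0"
    using assms False
    by (auto simp: lp_norm_def ennreal_powr_def ennreal_eq_0_iff enn2real_eq_0_iff split: if_splits)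
  have "infsum ?g {n} \<le> infsum ?g UNIV"
    by (rule infsum_mono_neutral) (auto intro: nonneg_summable_on_complete)
  with inf0 show ?thesis by (simp add: ennreal_eq_0_iff)
qed

lemma discrete_deriv_maximal_fun_const:
  assumes "\<And>i. f i = f 0"
  shows "discrete_deriv (maximal_fun f) = (\<lambda>_. 0)"
proof
  fix n
  have eq: "maximal_fun f m = \<bar>f 0\<bar>" for m
  proof -
    have "1 / real (card I) * (\<Sum>i\<in>I. \<bar>f i\<bar>) = \<bar>f 0\<bar>"
      if "int_interval I \<and> m \<in> I" for I
    proof -
      from that have "finite I" "I \<noteq> {}" by (auto simp: int_interval_def)
      moreover have "(\<Sum>i\<in>I. \<bar>f i\<bar>) = (\<Sum>i\<in>I. \<bar>f 0\<bar>)"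
        by (rule sum.cong[OF refl], subst assms, rule refl)
      ultimately show ?thesis by (simp add: card_gt_0_iff)
    qed
    moreover have "{m..m} \<in> {I. int_interval I \<and> m \<in> I}"
      unfolding int_interval_def by (auto intro!: exI[of _ m])
    ultimately have "(\<lambda>I. 1 / real (card I) * (\<Sum>i\<in>I. \<bar>f i\<bar>)) ` {I. int_interval I \<and> m \<in> I} = {\<bar>f 0\<bar>}"
      by (auto simp: image_iff)
    thus ?thesis by (simp add: maximal_fun_def)
  qed
  show "discrete_deriv (maximal_fun f) n = 0"
    by (simp add: discrete_deriv_def eq)
qed

lemma C1_admissible_Inf:
  assumes "1 \<le> p"
  shows "C1_admissible p (Inf {C. C1_admissible p C})"
  unfolding C1_admissible_def[of p "Inf _"]
proof (intro allI impI)
  fix S :: "int set"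
  let ?a = "lp_norm p (discrete_deriv (maximal_fun (indicator S)))"
  let ?b = "lp_norm p (discrete_deriv (indicator S))"
  assume fin: "?b < \<infinity>"
  show "?a \<le> Inf {C. C1_admissible p C} * ?b"
  proof (cases "?b = 0")
    case True
    have step: "(indicator S (i + 1) :: real) = indicator S i" for i
      using lp_norm_eq_0D[OF True, of i] by (simp add: discrete_deriv_def)
    have "(indicator S i :: real) = indicator S 0" for i
    proof (induction i rule: int_induct[where k = 0])
      case (step2 i)
      then show ?case using step[of "i - 1"] by simp
    qed (use step in simp_all)
    hence "?a = 0"
      using discrete_deriv_maximal_fun_const[of "indicator S"] lp_norm_zero[OF assms] by metis
    thus ?thesis by simp
  next
    case False
    have "?a / ?b \<le> Inf {C. C1_admissible p C}"
    proof (rule Inf_greatest)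
      fix C assume "C \<in> {C. C1_admissible p C}"
      hence "?a \<le> C * ?b" using fin by (auto simp: C1_admissible_def)
      thus "?a / ?b \<le> C" using False fin
        by (metis divide_le_posI_ennreal mult.commute zero_less_iff_neq_zero)
    qed
    hence "?a / ?b * ?b \<le> Inf {C. C1_admissible p C} * ?b"
      by (rule mult_right_mono) simp
    moreover have "?a / ?b * ?b = ?a"
      using False fin
      by (simp add: ennreal_divide_times ennreal_mult_divide_eq)
    ultimately show ?thesis by simp
  qed
qed

lemma C1_is_least:
  assumes "1 \<le> p"
  shows "C1_admissible p (C1 p)" and "C1_admissible p C \<Longrightarrow> C1 p \<le> C"
proof -
  have "C1 p = Inf {C. C1_admissible p C}"
    unfolding C1_def
    by (rule Least_equality) (auto intro: C1_admissible_Inf[OF assms] Inf_lower)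
  thus "C1_admissible p (C1 p)" and "C1_admissible p C \<Longrightarrow> C1 p \<le> C"
    using C1_admissible_Inf[OF assms] by (auto intro: Inf_lower)
qed

end

theory Submission
  imports Defs
begin

text \<open>Write \<open>M\<close> for the maximal function of \<open>\<chi>\<^sub>S\<close>. It equals 1 on \<open>S\<close> and is convex on every gap of \<open>S\<close>.
  If \<open>M\<close> decreases from \<open>n\<close> to \<open>n + 1\<close>, charge this step to the last point \<open>a\<close> of \<open>S\<close> up to \<open>n\<close>,
  which is a descent of \<open>\<chi>\<^sub>S\<close>. By convexity the steps \<open>d\<^sub>0, d\<^sub>1, \<dots>\<close> charged to \<open>a\<close> are decreasing, and
  \<open>M (a + m) \<ge> 1 / (m + 1)\<close> bounds their partial sums by \<open>1 - 1 / (m + 1)\<close>, the partial sums of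
  \<open>1 / n - 1 / (n + 1)\<close>. Karamata's inequality for \<open>x powr p\<close> therefore bounds their \<open>p\<close>-th powers, and
  the increasing steps are treated by reflection. All inequalities are equalities for \<open>S = {0}\<close>.\<close>

section \<open>Karamata's inequality for powers\<close>

lemma powr_above_tangent:
  fixes x y p :: real
  assumes "1 \<le> p" "0 \<le> x" "0 \<le> y"
  shows "x powr p + p * x powr (p - 1) * (y - x) \<le> y powr p"
proof (cases "x = 0 \<or> y = 0")
  \<comment> \<open>The tangent line argument runs on the open half-line, so zeros are treated
    apart. For \<open>x = 0\<close> the left side is 0, as \<open>0 powr r = 0\<close>; for
    \<open>y = 0\<close> the claim is \<open>x powr p \<le> p * x powr p\<close>.\<close>
  case True
  have "x powr p = x powr (p - 1) * x" using assms
    by (cases "x = 0") (simp_all add: powr_mult_base powr_diff)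
  moreover have "1 * (x powr (p - 1) * x) \<le> p * (x powr (p - 1) * x)"
    using assms by (intro mult_right_mono) auto
  ultimately show ?thesis using True assms
    by (auto simp: algebra_simps)
next
  case False
  hence "0 < x" "0 < y" using assms by auto
  have "p * x powr (p - 1) * (y - x) \<le> y powr p - x powr p"
  proof (rule convex_on_imp_above_tangent[where A = "{0<..}"])
    show "convex_on {0<..} (\<lambda>x. x powr p)" using powr_convex assms by blast
    show "((\<lambda>x. x powr p) has_real_derivative p * x powr (p - 1)) (at x within {0<..})"
      using \<open>0 < x\<close> by (auto intro!: derivative_eq_intros simp: field_simps powr_diff)
  qed (use \<open>0 < x\<close> \<open>0 < y\<close> in \<open>auto simp: interior_open\<close>)
  thus ?thesis by simp
qed

text \<open>Summation by parts: the right side exceeds the left by the sum of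
  \<open>w j - w (Suc j)\<close> times the partial sum of \<open>c\<close> up to and including
  \<open>j\<close>, a product of nonnegative factors.\<close>

lemma abel_sum_ge:
  fixes w c :: "nat \<Rightarrow> real"
  assumes w: "decseq w" and c: "\<And>m. 0 \<le> (\<Sum>j<m. c j)"
  shows "w m * (\<Sum>j<m. c j) \<le> (\<Sum>j<m. w j * c j)"
proof (induction m)
  case (Suc m)
  have "w (Suc m) * (\<Sum>j<Suc m. c j) \<le> w m * (\<Sum>j<Suc m. c j)"
    using w c[of "Suc m"] by (intro mult_right_mono) (auto simp: decseq_Suc_iff)
  also have "\<dots> \<le> (\<Sum>j<Suc m. w j * c j)"
    using Suc by (simp add: algebra_simps)
  finally show ?case .
qed simp

text \<open>The tangent at \<open>d j\<close> has slope \<open>w j\<close>, which decreases in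
  \<open>j\<close> because \<open>d\<close> does. Summation by parts then shows that the linear
  terms \<open>w j * (e j - d j)\<close> have a nonnegative sum. The totals of \<open>d\<close> and
  \<open>e\<close> may differ because the slopes are nonnegative.\<close>

lemma sum_powr_mono_majorized:
  fixes d e :: "nat \<Rightarrow> real"
  assumes p: "1 \<le> p" and d: "decseq d" "\<And>j. 0 \<le> d j" and e: "\<And>j. 0 \<le> e j"
    and maj: "\<And>m. (\<Sum>j<m. d j) \<le> (\<Sum>j<m. e j)"
  shows "(\<Sum>j<m. d j powr p) \<le> (\<Sum>j<m. e j powr p)"
proof -
  define w where "w j = p * d j powr (p - 1)" for j
  have "decseq w"
    using p d by (auto simp: w_def decseq_def intro!: mult_left_mono powr_mono2)
  hence "w m * (\<Sum>j<m. e j - d j) \<le> (\<Sum>j<m. w j * (e j - d j))"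
    using maj by (intro abel_sum_ge) (auto simp: sum_subtractf)
  moreover have "0 \<le> w m * (\<Sum>j<m. e j - d j)"
    using maj p by (auto simp: w_def sum_subtractf)
  moreover have "(\<Sum>j<m. d j powr p + w j * (e j - d j)) \<le> (\<Sum>j<m. e j powr p)"
    unfolding w_def using p d e by (intro sum_mono powr_above_tangent)
  ultimately show ?thesis by (simp add: sum.distrib)
qed

section \<open>Bounds, reflection and convexity for the maximal function\<close>

lemma maximal_fun_ge:
  assumes "\<And>i. \<bar>f i\<bar> \<le> (B::real)" "a \<le> n" "n \<le> b"
  shows "(\<Sum>i=a..b. \<bar>f i\<bar>) / (real_of_int (b - a) + 1) \<le> maximal_fun f n"
proof -
  have "1 / real (card {a..b}) * (\<Sum>i\<in>{a..b}. \<bar>f i\<bar>) \<le> maximal_fun f n"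
    unfolding maximal_fun_def using assms
    by (intro cSUP_upper bdd_above_averages[of f B]) (auto simp: int_interval_def)
  thus ?thesis using assms by (simp add: of_nat_nat)
qed

lemma maximal_fun_le:
  assumes "\<And>a b. a \<le> n \<Longrightarrow> n \<le> b \<Longrightarrow> (\<Sum>i=a..b. \<bar>f i\<bar>) / (real_of_int (b - a) + 1) \<le> C"
  shows "maximal_fun f n \<le> C"
  unfolding maximal_fun_def
proof (rule cSUP_least)
  show "{I. int_interval I \<and> n \<in> I} \<noteq> {}"
    by (auto simp: int_interval_def intro!: exI[of _ "{n..n}"] exI[of _ n])
next
  fix I assume "I \<in> {I. int_interval I \<and> n \<in> I}"
  then obtain a b where I: "I = {a..b}" "a \<le> n" "n \<le> b"
    by (auto simp: int_interval_def)
  thus "1 / real (card I) * (\<Sum>i\<in>I. \<bar>f i\<bar>) \<le> C"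
    using assms[of a b] by (simp add: of_nat_nat)
qed

text \<open>Negation maps the intervals containing \<open>n\<close> bijectively onto those
  containing \<open>- n\<close> and preserves cardinality. This reduces increasing steps to
  decreasing ones.\<close>

lemma maximal_fun_reflect: "maximal_fun (\<lambda>i. f (- i)) n = maximal_fun f (- n)"
proof -
  have uminus_interval: "int_interval (uminus ` I) \<longleftrightarrow> int_interval I" for I
  proof -
    have "int_interval (uminus ` I)" if "int_interval I" for I
      using that by (auto simp: int_interval_def image_uminus_atLeastAtMost intro: neg_le_iff_le[THEN iffD2])
    from this[of I] this[of "uminus ` I"] show ?thesis by (auto simp: image_image)
  qed
  have inv: "{I. int_interval I \<and> - n \<in> I} = image uminus ` {I. int_interval I \<and> n \<in> I}"
  proof safe
    fix I assume I: "int_interval I" "- n \<in> I"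
    hence "n \<in> uminus ` I" by force
    with I show "I \<in> image uminus ` {I. int_interval I \<and> n \<in> I}"
      by (intro image_eqI[of _ _ "uminus ` I"]) (auto simp: image_image uminus_interval)
  qed (auto simp: uminus_interval)
  show ?thesis
    unfolding maximal_fun_def inv image_image
    by (intro SUP_cong refl) (simp add: card_image sum.reindex)
qed

text \<open>An interval ending at the zero \<open>m\<close> of \<open>f\<close> can be lengthened or shortened by one point
  without changing its sum, and \<open>2 / L \<le> 1 / (L - 1) + 1 / (L + 1)\<close>.\<close>
lemma maximal_fun_convex_at_zero:
  assumes B: "\<And>i. \<bar>f i\<bar> \<le> (B::real)" and "f m = 0"
  shows "2 * maximal_fun f m \<le> maximal_fun f (m - 1) + maximal_fun f (m + 1)"
proof -
  have harmonic: "2 * (s / L) \<le> s / (L - 1) + s / (L + 1)" if "0 \<le> s" "1 < L" for s L :: real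
  proof -
    have "0 < L * L - 1" using that(2) mult_strict_mono[of 1 L 1 L] by auto
    hence "s / (L - 1) + s / (L + 1) - 2 * (s / L) = 2 * s / (L * (L * L - 1))"
      using that by (simp add: divide_simps) (simp add: algebra_simps)
    moreover have "0 \<le> 2 * s / (L * (L * L - 1))" using that \<open>0 < L * L - 1\<close> by simp
    ultimately show ?thesis by linarith
  qed
  note ge = maximal_fun_ge[of f B, OF B]
  have "maximal_fun f m \<le> (maximal_fun f (m - 1) + maximal_fun f (m + 1)) / 2"
  proof (rule maximal_fun_le)
    fix a b assume ab: "a \<le> m" "m \<le> b"
    define s L where "s = (\<Sum>i=a..b. \<bar>f i\<bar>)" and "L = real_of_int (b - a) + 1"
    have "0 \<le> s" by (simp add: s_def sum_nonneg)
    have "2 * (s / L) \<le> maximal_fun f (m - 1) + maximal_fun f (m + 1)"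
    proof (cases "a = m"; cases "b = m")
      \<comment> \<open>The average is 0 here; the singletons at the two neighbours show that the
        right side is nonnegative.\<close>
      assume "a = m" "b = m"
      thus ?thesis using ge[of "m - 1" "m - 1" "m - 1"] ge[of "m + 1" "m + 1" "m + 1"] assms(2)
        by (simp add: s_def)
    next
      assume "a = m" "b \<noteq> m"
      hence "{a..b} = insert m {m+1..b}" "{m-1..b} = insert (m-1) {a..b}" using ab by auto
      hence "s = (\<Sum>i=m+1..b. \<bar>f i\<bar>)" "s \<le> (\<Sum>i=m-1..b. \<bar>f i\<bar>)"
        using \<open>a = m\<close> assms(2) by (simp_all add: s_def)
      moreover have "1 < L" using \<open>a = m\<close> \<open>b \<noteq> m\<close> ab by (simp add: L_def)
      ultimately have "s / (L - 1) \<le> maximal_fun f (m + 1)" "s / (L + 1) \<le> maximal_fun f (m - 1)"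
        using ge[of "m+1" "m+1" b] ge[of "m-1" "m-1" b] \<open>a = m\<close> \<open>b \<noteq> m\<close> ab
          divide_right_mono[of s "\<Sum>i=m-1..b. \<bar>f i\<bar>" "L + 1"]
        by (auto simp: L_def algebra_simps)
      thus ?thesis using harmonic[OF \<open>0 \<le> s\<close> \<open>1 < L\<close>] by linarith
    next
      assume "a \<noteq> m" "b = m"
      hence "{a..b} = insert m {a..m-1}" "{a..m+1} = insert (m+1) {a..b}" using ab by auto
      hence "s = (\<Sum>i=a..m-1. \<bar>f i\<bar>)" "s \<le> (\<Sum>i=a..m+1. \<bar>f i\<bar>)"
        using \<open>b = m\<close> assms(2) by (simp_all add: s_def)
      moreover have "1 < L" using \<open>a \<noteq> m\<close> \<open>b = m\<close> ab by (simp add: L_def)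
      ultimately have "s / (L - 1) \<le> maximal_fun f (m - 1)" "s / (L + 1) \<le> maximal_fun f (m + 1)"
        using ge[of a "m-1" "m-1"] ge[of a "m+1" "m+1"] \<open>a \<noteq> m\<close> \<open>b = m\<close> ab
          divide_right_mono[of s "\<Sum>i=a..m+1. \<bar>f i\<bar>" "L + 1"]
        by (auto simp: L_def algebra_simps)
      thus ?thesis using harmonic[OF \<open>0 \<le> s\<close> \<open>1 < L\<close>] by linarith
    next
      \<comment> \<open>The interval contains both neighbours of \<open>m\<close>, so its average
        bounds both of their values from below.\<close>
      assume "a \<noteq> m" "b \<noteq> m"
      thus ?thesis using ge[of a "m-1" b] ge[of a "m+1" b] ab by (simp add: s_def L_def)
    qed
    thus "(\<Sum>i=a..b. \<bar>f i\<bar>) / (real_of_int (b - a) + 1)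
        \<le> (maximal_fun f (m - 1) + maximal_fun f (m + 1)) / 2"
      unfolding s_def[symmetric] L_def[symmetric]
      by (simp only: pos_le_divide_eq zero_less_numeral mult.commute)
  qed
  thus ?thesis by simp
qed

lemma maximal_fun_le_bound:
  assumes "\<And>i. \<bar>f i\<bar> \<le> (B::real)"
  shows "maximal_fun f n \<le> B"
proof (rule maximal_fun_le)
  fix a b assume "a \<le> n" "n \<le> b"
  moreover from this have "(\<Sum>i=a..b. \<bar>f i\<bar>) \<le> (real_of_int (b - a) + 1) * B"
    using sum_bounded_above[of "{a..b}" "\<lambda>i. \<bar>f i\<bar>" B] assms by (simp add: of_nat_nat add.commute)
  ultimately show "(\<Sum>i=a..b. \<bar>f i\<bar>) / (real_of_int (b - a) + 1) \<le> B"
    by (simp add: divide_le_eq mult.commute)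
qed

section \<open>The maximal function of a characteristic function\<close>

lemma abs_indicator_le_1: "\<bar>indicator S i :: real\<bar> \<le> 1"
  by (simp add: indicator_def)

lemma maximal_indicator_ge:
  assumes "a \<le> n" "n \<le> b"
  shows "(\<Sum>i=a..b. \<bar>indicator S i\<bar>) / (real_of_int (b - a) + 1) \<le> maximal_fun (indicator S) n"
  using abs_indicator_le_1 assms by (rule maximal_fun_ge)

lemma maximal_indicator_le_1: "maximal_fun (indicator S) n \<le> 1"
  using abs_indicator_le_1 by (rule maximal_fun_le_bound)

lemma maximal_indicator_nonneg: "0 \<le> maximal_fun (indicator S) n"
  using maximal_indicator_ge[of n n n S] by (simp add: indicator_def split: if_splits)

lemma maximal_indicator_mem: "n \<in> S \<Longrightarrow> maximal_fun (indicator S) n = 1"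
  using maximal_indicator_ge[of n n n S] maximal_indicator_le_1[of S n] by simp

lemma maximal_indicator_ge_inverse_distance:
  assumes "a \<in> S"
  shows "1 / (real j + 1) \<le> maximal_fun (indicator S) (a + int j)"
proof -
  have "(1::real) \<le> (\<Sum>i=a..a + int j. \<bar>indicator S i\<bar>)"
    using member_le_sum[of a "{a..a + int j}" "\<lambda>i. \<bar>indicator S i :: real\<bar>"] assms by simp
  hence "1 / (real j + 1) \<le> (\<Sum>i=a..a + int j. \<bar>indicator S i\<bar>) / (real j + 1)"
    by (intro divide_right_mono) auto
  also have "\<dots> \<le> maximal_fun (indicator S) (a + int j)"
    using maximal_indicator_ge[of a "a + int j" "a + int j" S] by simp
  finally show ?thesis .
qed

text \<open>The maximal function attains its upper bound 1 on \<open>S\<close>, so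
  \<open>n + 1\<close> lies outside \<open>S\<close>. If \<open>S\<close> had no point up to
  \<open>n\<close>, an interval containing \<open>n\<close> would either end at \<open>n\<close> and
  have average 0, or also contain \<open>n + 1\<close>; neither permits a descent. The point
  \<open>a\<close> is the last one of \<open>S\<close> up to \<open>n\<close>.\<close>

lemma maximal_indicator_descentE:
  assumes less: "maximal_fun (indicator S) (n + 1) < maximal_fun (indicator S) n"
  obtains a j where "a \<in> S" "{a<..n + 1} \<inter> S = {}" "n = a + int j"
proof -
  have "n + 1 \<notin> S"
    using less maximal_indicator_mem[of "n + 1" S] maximal_indicator_le_1[of S n] by auto
  have "\<exists>j. n - int j \<in> S"
  proof (rule ccontr)
    assume none: "\<nexists>j. n - int j \<in> S"
    have notin: "i \<notin> S" if "i \<le> n" for i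
      using none that by (metis diff_diff_eq2 add_diff_cancel_left' zle_iff_zadd diff_add_cancel)
    have "maximal_fun (indicator S) n \<le> maximal_fun (indicator S) (n + 1)"
    proof (rule maximal_fun_le)
      fix a b assume ab: "a \<le> n" "n \<le> b"
      show "(\<Sum>i=a..b. \<bar>indicator S i\<bar>) / (real_of_int (b - a) + 1)
          \<le> maximal_fun (indicator S) (n + 1)"
      proof (cases "b = n")
        case True
        hence "(\<Sum>i=a..b. \<bar>indicator S i :: real\<bar>) = 0" using notin by (intro sum.neutral) auto
        thus ?thesis using maximal_indicator_nonneg by simp
      next
        case False
        thus ?thesis using ab by (intro maximal_indicator_ge) auto
      qed
    qed
    with less show False by simp
  qed
  define j where "j = (LEAST j. n - int j \<in> S)"
  have "n - int j \<in> S" using LeastI_ex[OF \<open>\<exists>j. n - int j \<in> S\<close>] by (simp add: j_def)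
  moreover have "i \<notin> S" if "n - int j < i" "i \<le> n + 1" for i
  proof (cases "i = n + 1")
    case False
    hence "n - int (nat (n - i)) = i" "nat (n - i) < j" using that by auto
    thus ?thesis using not_less_Least[of "nat (n - i)" "\<lambda>j. n - int j \<in> S"] by (simp add: j_def)
  qed (use \<open>n + 1 \<notin> S\<close> in auto)
  ultimately show ?thesis by (intro that[of "n - int j" j]) auto
qed

section \<open>Descents and their charging to points of \<open>S\<close>\<close>

text \<open>The negative part of \<open>discrete_deriv f\<close>.\<close>

definition descent :: "(int \<Rightarrow> real) \<Rightarrow> int \<Rightarrow> real" where
  "descent f n = max 0 (f n - f (n + 1))"

lemma descent_nonneg [simp]: "0 \<le> descent f n"
  by (simp add: descent_def)

text \<open>The \<open>j\<close>-th step charged to \<open>a\<close>; setting it to 0 past the end of the gap keeps the sequence decreasing.\<close>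
definition gap_descent :: "int set \<Rightarrow> int \<Rightarrow> nat \<Rightarrow> real" where
  "gap_descent S a j =
     (if {a<..a + int j + 1} \<inter> S = {} then descent (maximal_fun (indicator S)) (a + int j) else 0)"

lemma gap_descent_nonneg [simp]: "0 \<le> gap_descent S a j"
  by (simp add: gap_descent_def)

text \<open>Within the gap this is convexity at the zero \<open>a + int j + 1\<close> of the
  indicator. Once the gap has ended the value stays 0, since the ranges tested for disjointness from
  \<open>S\<close> increase with \<open>j\<close>.\<close>

lemma decseq_gap_descent: "decseq (gap_descent S a)"
  unfolding decseq_Suc_iff
proof
  fix j
  show "gap_descent S a (Suc j) \<le> gap_descent S a j"
  proof (cases "{a<..a + int (Suc j) + 1} \<inter> S = {}")
    case True
    moreover have "{a<..a + int j + 1} \<subseteq> {a<..a + int (Suc j) + 1}" by auto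
    ultimately have gap: "{a<..a + int j + 1} \<inter> S = {}" by blast
    have "a + int j + 1 \<in> {a<..a + int j + 1}" by simp
    with gap have "a + int j + 1 \<notin> S" by blast
    hence "2 * maximal_fun (indicator S) (a + int j + 1)
        \<le> maximal_fun (indicator S) (a + int j) + maximal_fun (indicator S) (a + int j + 1 + 1)"
      using maximal_fun_convex_at_zero[of "indicator S" 1 "a + int j + 1"] by (simp add: abs_indicator_le_1)
    moreover have "a + int (Suc j) = a + int j + 1" by simp
    ultimately show ?thesis using True gap by (simp add: gap_descent_def descent_def add_ac)
  qed (simp add: gap_descent_def)
qed

lemma sum_inverse_telescope:
  "(\<Sum>j<m. 1 / (real j + 1) - 1 / (real j + 2)) = 1 - 1 / (real m + 1)"
  by (induction m) (simp_all add: add_ac)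

text \<open>If the last term is 0, the bound for one term fewer suffices. Otherwise monotonicity
  makes every term positive, hence a true difference of the maximal function, and the sum telescopes
  from the value 1 at \<open>a\<close>.\<close>

lemma sum_gap_descent_le:
  assumes "a \<in> S"
  shows "(\<Sum>j<m. gap_descent S a j) \<le> 1 - 1 / (real m + 1)"
proof (induction m)
  case (Suc m)
  show ?case
  proof (cases "gap_descent S a m = 0")
    case True
    moreover have "1 / (real (Suc m) + 1) \<le> 1 / (real m + 1)" by (simp add: frac_le)
    ultimately show ?thesis using Suc by simp
  next
    case False
    let ?f = "\<lambda>j. maximal_fun (indicator S) (a + int j)"
    have "gap_descent S a j = ?f j - ?f (Suc j)" if "j < Suc m" for j
    proof -
      have "gap_descent S a m \<le> gap_descent S a j"
        using decseqD[OF decseq_gap_descent, of j m] that by simp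
      hence "0 < gap_descent S a j" using False gap_descent_nonneg[of S a m] by linarith
      thus ?thesis by (auto simp: gap_descent_def descent_def add_ac split: if_splits)
    qed
    hence "(\<Sum>j<Suc m. gap_descent S a j) = (\<Sum>j<Suc m. ?f j - ?f (Suc j))"
      by (intro sum.cong) auto
    also have "\<dots> = 1 - ?f (Suc m)"
      using maximal_indicator_mem[OF assms] by (subst sum_lessThan_telescope') simp
    also have "\<dots> \<le> 1 - 1 / (real (Suc m) + 1)"
      using maximal_indicator_ge_inverse_distance[OF assms, of "Suc m"] by simp
    finally show ?thesis .
  qed
qed simp

lemma sum_gap_descent_powr_le:
  assumes "a \<in> S" "1 \<le> q"
  shows "(\<Sum>j<m. gap_descent S a j powr q) \<le> (\<Sum>j<m. (1 / (real j + 1) - 1 / (real j + 2)) powr q)"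
  using assms sum_gap_descent_le[OF assms(1)] decseq_gap_descent
  by (intro sum_powr_mono_majorized) (auto simp: sum_inverse_telescope frac_le)

text \<open>A descent is at most the first step charged to the same point, and that step is at most
  \<open>1 - 1 / 2\<close>.\<close>

lemma descent_maximal_indicator_le_half: "descent (maximal_fun (indicator S)) n \<le> 1 / 2"
proof (cases "maximal_fun (indicator S) (n + 1) < maximal_fun (indicator S) n")
  case True
  then obtain a j where aj: "a \<in> S" "{a<..n + 1} \<inter> S = {}" "n = a + int j"
    by (rule maximal_indicator_descentE)
  hence "descent (maximal_fun (indicator S)) n = gap_descent S a j"
    by (simp add: gap_descent_def)
  also have "\<dots> \<le> gap_descent S a 0" using decseqD[OF decseq_gap_descent] by simp
  also have "\<dots> \<le> 1 / 2" using sum_gap_descent_le[OF aj(1), of 1] by simp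
  finally show ?thesis .
qed (simp add: descent_def)

section \<open>Summation over all descents\<close>

lemma sum_le_infsum_ennreal:
  fixes f :: "'a \<Rightarrow> ennreal"
  assumes "finite F" "F \<subseteq> A"
  shows "sum f F \<le> infsum f A"
  using assms by (subst nonneg_infsum_complete) (auto intro: SUP_upper)

text \<open>The \<open>q\<close>-th power of the claimed constant for the exponent \<open>q\<close>,
  taken in \<open>ennreal\<close>, where every family is summable.\<close>

definition extremal_sum :: "real \<Rightarrow> ennreal" where
  "extremal_sum q = (\<Sum>\<^sub>\<infinity>n\<in>{1::nat..}. ennreal ((1 / real n - 1 / real (n + 1)) powr q))"

lemma sum_le_extremal_sum:
  "ennreal (\<Sum>j<m. (1 / (real j + 1) - 1 / (real j + 2)) powr q) \<le> extremal_sum q"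
proof -
  have "ennreal (\<Sum>j<m. (1 / (real j + 1) - 1 / (real j + 2)) powr q)
      = (\<Sum>j<m. ennreal ((1 / (real j + 1) - 1 / (real j + 2)) powr q))"
    by simp
  also have "\<dots> = (\<Sum>n\<in>Suc ` {..<m}. ennreal ((1 / real n - 1 / real (n + 1)) powr q))"
    by (subst sum.reindex) (auto simp: add_ac)
  also have "\<dots> \<le> extremal_sum q"
    unfolding extremal_sum_def by (intro sum_le_infsum_ennreal) auto
  finally show ?thesis .
qed

text \<open>Each point of \<open>S\<close> receives charges of total \<open>q\<close>-th power at
  most \<open>extremal_sum q\<close>, and only points \<open>a\<close> with \<open>a + 1\<close>
  outside \<open>S\<close> are charged. Each of these contributes exactly 1 to the sum on the
  right.\<close>

lemma infsum_descent_maximal_indicator_le: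
  assumes "1 \<le> q"
  shows "(\<Sum>\<^sub>\<infinity>n. ennreal (descent (maximal_fun (indicator S)) n powr q))
    \<le> extremal_sum q * (\<Sum>\<^sub>\<infinity>n. ennreal (descent (indicator S) n powr q))"
proof (rule infsum_le_finite_sums)
  fix F :: "int set" assume "finite F"
  let ?M = "maximal_fun (indicator S)"
  define F' where "F' = {n\<in>F. ?M (n + 1) < ?M n}"
  have "finite F'" using \<open>finite F\<close> by (simp add: F'_def)
  define P where "P n aj \<longleftrightarrow> fst aj \<in> S \<and> {fst aj<..n + 1} \<inter> S = {} \<and> n = fst aj + int (snd aj)"
    for n and aj :: "int \<times> nat"
  have "\<exists>aj. P n aj" if "n \<in> F'" for n
  proof -
    have "?M (n + 1) < ?M n" using that by (simp add: F'_def)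
    then obtain a j where "a \<in> S" "{a<..n + 1} \<inter> S = {}" "n = a + int j"
      by (rule maximal_indicator_descentE)
    hence "P n (a, j)" unfolding P_def by simp
    thus ?thesis ..
  qed
  hence "\<forall>n\<in>F'. \<exists>aj. P n aj" by blast
  then obtain h where "\<forall>n\<in>F'. P n (h n)" by (rule bchoice[THEN exE])
  hence h: "fst (h n) \<in> S" "{fst (h n)<..n + 1} \<inter> S = {}" "n = fst (h n) + int (snd (h n))"
    if "n \<in> F'" for n
    using that unfolding P_def by blast+
  \<comment> \<open>\<open>R\<close> collects the charged points, and \<open>N\<close> is a common
    strict bound on the offsets, so that all charges lie in the rectangle
    \<open>R \<times> {..<N}\<close>.\<close>
  define R N where "R = fst ` h ` F'" and "N = Suc (Max (snd ` h ` F'))"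
  have N: "snd (h n) < N" if "n \<in> F'" for n
    using that \<open>finite F'\<close> by (auto simp: N_def less_Suc_eq_le intro!: Max_ge)
  have "finite R" using \<open>finite F'\<close> by (simp add: R_def)
  have R: "a \<in> S" "a + 1 \<notin> S" if "a \<in> R" for a
  proof -
    obtain n where n: "n \<in> F'" "a = fst (h n)" using \<open>a \<in> R\<close> by (auto simp: R_def)
    thus "a \<in> S" using h by simp
    have "a + 1 \<in> {fst (h n)<..n + 1}" using n h(3)[of n] by auto
    thus "a + 1 \<notin> S" using h(2)[OF n(1)] by blast
  qed
  \<comment> \<open>The pair \<open>(a, j)\<close> determines \<open>n = a + int j\<close>.\<close>
  have inj: "inj_on h F'" using h(3) by (metis inj_onI)
  have "(\<Sum>n\<in>F. descent ?M n powr q) = (\<Sum>n\<in>F'. descent ?M n powr q)"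
    using \<open>finite F\<close> by (intro sum.mono_neutral_right) (auto simp: F'_def descent_def)
  also have "\<dots> = (\<Sum>n\<in>F'. gap_descent S (fst (h n)) (snd (h n)) powr q)"
    using h by (intro sum.cong) (auto simp: gap_descent_def)
  also have "\<dots> = (\<Sum>(a, j)\<in>h ` F'. gap_descent S a j powr q)"
    using inj by (simp add: sum.reindex case_prod_unfold)
  finally have sum_F: "(\<Sum>n\<in>F. descent ?M n powr q) = (\<Sum>(a, j)\<in>h ` F'. gap_descent S a j powr q)" .
  have "h ` F' \<subseteq> R \<times> {..<N}"
    using N by (intro image_subsetI) (simp add: R_def mem_Times_iff)
  hence "(\<Sum>n\<in>F. descent ?M n powr q) \<le> (\<Sum>(a, j)\<in>R \<times> {..<N}. gap_descent S a j powr q)"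
    unfolding sum_F using \<open>finite R\<close> by (intro sum_mono2) auto
  also have "\<dots> = (\<Sum>a\<in>R. \<Sum>j<N. gap_descent S a j powr q)"
    by (simp add: sum.cartesian_product)
  also have "\<dots> \<le> (\<Sum>a\<in>R. \<Sum>j<N. (1 / (real j + 1) - 1 / (real j + 2)) powr q)"
    using R assms by (intro sum_mono sum_gap_descent_powr_le)
  finally have "ennreal (\<Sum>n\<in>F. descent ?M n powr q)
      \<le> ennreal (\<Sum>a\<in>R. \<Sum>j<N. (1 / (real j + 1) - 1 / (real j + 2)) powr q)"
    by (rule ennreal_leI)
  also have "\<dots> = (\<Sum>a\<in>R. ennreal (\<Sum>j<N. (1 / (real j + 1) - 1 / (real j + 2)) powr q))"
    by (intro sum_ennreal[symmetric] sum_nonneg) auto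
  also have "\<dots> \<le> (\<Sum>a\<in>R. extremal_sum q)"
    by (intro sum_mono sum_le_extremal_sum)
  also have "\<dots> = extremal_sum q * (\<Sum>a\<in>R. ennreal (descent (indicator S) a powr q))"
    using R by (simp add: descent_def mult.commute)
  also have "\<dots> \<le> extremal_sum q * (\<Sum>\<^sub>\<infinity>a. ennreal (descent (indicator S) a powr q))"
    using \<open>finite R\<close> by (intro mult_left_mono sum_le_infsum_ennreal) auto
  finally show "(\<Sum>n\<in>F. ennreal (descent ?M n powr q))
      \<le> extremal_sum q * (\<Sum>\<^sub>\<infinity>n. ennreal (descent (indicator S) n powr q))"
    by simp
qed (auto intro: nonneg_summable_on_complete)

section \<open>Roots in \<open>ennreal\<close>, and the passage from descents to derivatives\<close>

lemma ennreal_powr_mult: "ennreal_powr (x * y) r = ennreal_powr x r * ennreal_powr y r"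
proof (cases "x = \<infinity> \<or> y = \<infinity>")
  \<comment> \<open>Both sides are infinite unless the other factor is 0; then both are 0, by
    \<open>0 powr r = 0\<close> and \<infinity> * 0 = 0.\<close>
  case True
  thus ?thesis
    by (auto simp: ennreal_powr_def ennreal_top_mult ennreal_mult_top enn2real_eq_0_iff)
next
  case False
  hence "x * y \<noteq> \<infinity>" by (simp add: ennreal_mult_eq_top_iff)
  thus ?thesis using False
    by (simp add: ennreal_powr_def enn2real_mult powr_mult ennreal_mult)
qed

lemma ennreal_powr_mono:
  assumes "0 \<le> r" "x \<le> y"
  shows "ennreal_powr x r \<le> ennreal_powr y r"
proof (cases "y = \<infinity>")
  case False
  moreover from this have "x \<noteq> \<infinity>" using assms by (auto simp: top_unique)
  ultimately show ?thesis using assms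
    by (auto simp: ennreal_powr_def less_top intro!: ennreal_leI powr_mono2 enn2real_mono)
qed (simp add: ennreal_powr_def)

text \<open>Reflection turns the step from \<open>n\<close> to \<open>n + 1\<close> into the step
  from \<open>- n - 1\<close> to \<open>- n\<close>, and so ascents into descents.\<close>

lemma abs_discrete_deriv:
  "\<bar>discrete_deriv f n\<bar> = max (descent f n) (descent (\<lambda>i. f (- i)) (- n - 1))"
  by (simp add: discrete_deriv_def descent_def add.commute[of 1])

text \<open>At each \<open>n\<close> at least one of the two descents vanishes, so the power of
  their maximum is the sum of their powers.\<close>

lemma infsum_discrete_deriv_powr:
  "(\<Sum>\<^sub>\<infinity>n. ennreal (\<bar>discrete_deriv f n\<bar> powr q))
    = (\<Sum>\<^sub>\<infinity>n. ennreal (descent f n powr q)) + (\<Sum>\<^sub>\<infinity>n. ennreal (descent (\<lambda>i. f (- i)) n powr q))"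
proof -
  have bij: "bij_betw (\<lambda>n::int. - n - 1) UNIV UNIV"
    by (rule bij_betw_byWitness[where f' = "\<lambda>n. - n - 1"]) auto
  have "ennreal (\<bar>discrete_deriv f n\<bar> powr q)
      = ennreal (descent f n powr q) + ennreal (descent (\<lambda>i. f (- i)) (- n - 1) powr q)" for n
    by (simp add: discrete_deriv_def descent_def max_def abs_if add.commute[of 1])
  hence "(\<Sum>\<^sub>\<infinity>n. ennreal (\<bar>discrete_deriv f n\<bar> powr q)) = (\<Sum>\<^sub>\<infinity>n. ennreal (descent f n powr q))
      + (\<Sum>\<^sub>\<infinity>n. ennreal (descent (\<lambda>i. f (- i)) (- n - 1) powr q))"
    by (simp add: infsum_add nonneg_summable_on_complete)
  also have "(\<Sum>\<^sub>\<infinity>n. ennreal (descent (\<lambda>i. f (- i)) (- n - 1) powr q))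
      = (\<Sum>\<^sub>\<infinity>n. ennreal (descent (\<lambda>i. f (- i)) n powr q))"
    using infsum_reindex_bij_betw[OF bij, of "\<lambda>n. ennreal (descent (\<lambda>i. f (- i)) n powr q)"] .
  finally show ?thesis .
qed

lemma indicator_reflect: "(\<lambda>i. indicator S (- i)) = (indicator (uminus ` S) :: int \<Rightarrow> real)"
proof
  fix i :: int
  have "- i \<in> S \<longleftrightarrow> i \<in> uminus ` S" by force
  thus "indicator S (- i) = (indicator (uminus ` S) i :: real)" by (simp add: indicator_def)
qed

lemma maximal_indicator_reflect:
  "(\<lambda>i. maximal_fun (indicator S) (- i)) = maximal_fun (indicator (uminus ` S))"
  using maximal_fun_reflect[of "indicator S"] by (auto simp: indicator_reflect)

lemma infsum_deriv_maximal_indicator_le: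
  assumes "1 \<le> q"
  shows "(\<Sum>\<^sub>\<infinity>n. ennreal (\<bar>discrete_deriv (maximal_fun (indicator S)) n\<bar> powr q))
    \<le> extremal_sum q * (\<Sum>\<^sub>\<infinity>n. ennreal (\<bar>discrete_deriv (indicator S) n\<bar> powr q))"
  unfolding infsum_discrete_deriv_powr maximal_indicator_reflect indicator_reflect distrib_left
  by (intro add_mono infsum_descent_maximal_indicator_le assms)

section \<open>The extremizer\<close>

text \<open>The shortest interval containing both 0 and \<open>n\<close> is optimal; intervals that
  miss 0 have average 0.\<close>

lemma maximal_indicator_zero: "maximal_fun (indicator {0}) n = 1 / (\<bar>real_of_int n\<bar> + 1)"
proof (rule antisym)
  show "maximal_fun (indicator {0}) n \<le> 1 / (\<bar>real_of_int n\<bar> + 1)"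
  proof (rule maximal_fun_le)
    fix a b assume ab: "a \<le> n" "n \<le> b"
    show "(\<Sum>i=a..b. \<bar>indicator {0} i\<bar>) / (real_of_int (b - a) + 1) \<le> 1 / (\<bar>real_of_int n\<bar> + 1)"
    proof (cases "a \<le> 0 \<and> 0 \<le> b")
      case True
      hence "\<bar>n\<bar> \<le> b - a" using ab by linarith
      hence "\<bar>real_of_int n\<bar> \<le> real_of_int (b - a)" by (metis of_int_abs of_int_le_iff)
      moreover have "(\<Sum>i=a..b. \<bar>indicator {0} i :: real\<bar>) = 1"
        using True by (subst sum.remove[of _ 0]) (auto intro!: sum.neutral)
      ultimately show ?thesis by (simp add: frac_le)
    next
      case False
      hence "(\<Sum>i=a..b. \<bar>indicator {0} i :: real\<bar>) = 0" by (intro sum.neutral) auto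
      thus ?thesis by simp
    qed
  qed
next
  have nonneg: "1 / (real j + 1) \<le> maximal_fun (indicator {0}) (int j)" for j
    using maximal_indicator_ge_inverse_distance[of 0 "{0}" j] by simp
  have reflect: "maximal_fun (indicator {0}) (- int j) = maximal_fun (indicator {0}) (int j)" for j
    using maximal_indicator_reflect[of "{0}"] by (simp add: fun_eq_iff)
  show "1 / (\<bar>real_of_int n\<bar> + 1) \<le> maximal_fun (indicator {0}) n"
    using nonneg by (cases n rule: int_cases2) (simp_all add: reflect)
qed

lemma infsum_deriv_indicator_zero:
  "(\<Sum>\<^sub>\<infinity>n. ennreal (\<bar>discrete_deriv (indicator {0}) n\<bar> powr q)) = 2"
proof -
  have "(\<Sum>\<^sub>\<infinity>n. ennreal (descent (indicator {0}) n powr q)) = (\<Sum>\<^sub>\<infinity>n\<in>{0::int}. 1)"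
    by (rule infsum_cong_neutral) (auto simp: descent_def indicator_def)
  thus ?thesis by (simp add: infsum_discrete_deriv_powr indicator_reflect)
qed

text \<open>The descents occur exactly at \<open>n \<ge> 0\<close> and run through the extremal
  differences; the factor 2 accounts for the mirror-image ascents.\<close>

lemma infsum_deriv_maximal_indicator_zero:
  "(\<Sum>\<^sub>\<infinity>n. ennreal (\<bar>discrete_deriv (maximal_fun (indicator {0})) n\<bar> powr q)) = extremal_sum q * 2"
proof -
  have bij: "bij_betw (\<lambda>n. int n - 1) {1..} {0..}"
    by (rule bij_betw_byWitness[where f' = "\<lambda>n. nat (n + 1)"]) auto
  have "descent (maximal_fun (indicator {0})) n
      = (if 0 \<le> n then 1 / (real_of_int n + 1) - 1 / (real_of_int n + 2) else 0)" for n
  proof (cases "0 \<le> n")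
    case False
    hence "\<bar>real_of_int (n + 1)\<bar> + 1 \<le> \<bar>real_of_int n\<bar> + 1" by linarith
    hence "1 / (\<bar>real_of_int n\<bar> + 1) \<le> 1 / (\<bar>real_of_int (n + 1)\<bar> + 1)"
      by (intro frac_le) auto
    thus ?thesis using False by (simp add: descent_def maximal_indicator_zero)
  qed (simp add: descent_def maximal_indicator_zero frac_le max_def add_ac)
  hence "(\<Sum>\<^sub>\<infinity>n. ennreal (descent (maximal_fun (indicator {0})) n powr q))
      = (\<Sum>\<^sub>\<infinity>n\<in>{0::int..}. ennreal ((1 / (real_of_int n + 1) - 1 / (real_of_int n + 2)) powr q))"
    by (intro infsum_cong_neutral) auto
  also have "\<dots> = extremal_sum q"
    unfolding extremal_sum_def
    by (subst infsum_reindex_bij_betw[OF bij, symmetric]) (simp add: add_ac)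
  finally show ?thesis
    by (simp add: infsum_discrete_deriv_powr maximal_indicator_reflect mult_2_right)
qed

section \<open>The exponent \<infinity>\<close>

lemma ennreal_half: "ennreal (1 / 2) = 1 / 2"
  using divide_ennreal[of 1 2] by simp

lemma C1_admissible_infinity: "C1_admissible \<infinity> (1 / 2)"
  unfolding C1_admissible_def
proof (intro allI impI)
  fix S :: "int set"
  let ?D = "SUP n. ennreal \<bar>discrete_deriv (indicator S) n\<bar>"
  have "ennreal \<bar>discrete_deriv (maximal_fun (indicator S)) n\<bar> \<le> 1 / 2 * ?D" for n
  \<comment> \<open>The derivative of an indicator takes only the values -1, 0 and 1. So either the
    indicator is constant, and with it the maximal function, or \<open>?D\<close> is at least 1 and
    the pointwise bound \<open>1 / 2\<close> suffices.\<close>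
  proof (cases "?D = 0")
    case True
    hence "lp_norm \<infinity> (discrete_deriv (indicator S)) = 0" by (simp add: lp_norm_def)
    hence step: "discrete_deriv (indicator S) i = 0" for i by (rule lp_norm_eq_0D)
    hence step: "indicator S (i + 1) = (indicator S i :: real)" for i
      by (simp add: discrete_deriv_def)
    have "(indicator S i :: real) = indicator S 0" for i
    proof (induction i rule: int_induct[where k = 0])
      case (step2 i)
      thus ?case using step[of "i - 1"] by simp
    qed (use step in simp_all)
    from discrete_deriv_maximal_fun_const[of "indicator S", OF this] show ?thesis by simp
  next
    case False
    then obtain i where "discrete_deriv (indicator S) i \<noteq> 0" by (auto simp: SUP_eq_iff)
    hence "\<bar>discrete_deriv (indicator S) i\<bar> = 1"
      by (auto simp: discrete_deriv_def indicator_def split: if_splits)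
    hence "1 \<le> ?D" by (metis SUP_upper UNIV_I ennreal_1)
    have "\<bar>discrete_deriv (maximal_fun (indicator S)) n\<bar> \<le> 1 / 2"
      unfolding abs_discrete_deriv maximal_indicator_reflect
      by (intro max.boundedI descent_maximal_indicator_le_half)
    hence "ennreal \<bar>discrete_deriv (maximal_fun (indicator S)) n\<bar> \<le> ennreal (1 / 2)"
      by (rule ennreal_leI)
    also have "ennreal (1 / 2) = 1 / 2 * 1" by (simp only: ennreal_half mult_1_right)
    also have "\<dots> \<le> 1 / 2 * ?D" using \<open>1 \<le> ?D\<close> by (rule mult_left_mono) simp
    finally show ?thesis .
  qed
  thus "lp_norm \<infinity> (discrete_deriv (maximal_fun (indicator S)))
      \<le> 1 / 2 * lp_norm \<infinity> (discrete_deriv (indicator S))"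
    by (simp add: lp_norm_def SUP_le_iff)
qed

lemma SUP_inverse_differences:
  "(SUP n\<in>{1::nat..}. ennreal (1 / real n - 1 / real (n + 1))) = 1 / 2"
proof (rule antisym)
  have "1 / real n - 1 / real (n + 1) \<le> 1 / 2" if "1 \<le> n" for n
  proof -
    have "1 / real n - 1 / real (n + 1) = 1 / (real n * real (n + 1))"
      using that by (simp add: field_simps)
    also have "\<dots> \<le> 1 / (1 * 2)" using that by (intro frac_le mult_mono) auto
    finally show ?thesis by simp
  qed
  thus "(SUP n\<in>{1::nat..}. ennreal (1 / real n - 1 / real (n + 1))) \<le> 1 / 2"
    unfolding ennreal_half[symmetric] by (intro SUP_least ennreal_leI) auto
  show "1 / 2 \<le> (SUP n\<in>{1::nat..}. ennreal (1 / real n - 1 / real (n + 1)))"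
    unfolding ennreal_half[symmetric] by (rule SUP_upper2[of 1]) simp_all
qed

section \<open>Identification of the least constant\<close>

text \<open>A single set for which an admissible \<open>K\<close> is attained makes \<open>K\<close>
  least: its derivative norm is neither 0 nor \<infinity> and can be cancelled.\<close>

lemma C1_eqI:
  assumes "1 \<le> p" "C1_admissible p K"
    and "lp_norm p (discrete_deriv (indicator S)) \<noteq> 0" "lp_norm p (discrete_deriv (indicator S)) < \<infinity>"
    and ge: "K * lp_norm p (discrete_deriv (indicator S))
      \<le> lp_norm p (discrete_deriv (maximal_fun (indicator S)))"
  shows "C1 p = K"
    and "lp_norm p (discrete_deriv (maximal_fun (indicator S)))
      = K * lp_norm p (discrete_deriv (indicator S))"
proof -
  let ?b = "lp_norm p (discrete_deriv (indicator S))"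
  have "K * ?b \<le> C1 p * ?b"
    using C1_is_least(1)[OF assms(1)] assms(4) ge unfolding C1_admissible_def
    by (blast intro: order_trans)
  hence "K * ?b / ?b \<le> C1 p * ?b / ?b" by (rule divide_right_mono_ennreal)
  hence "K \<le> C1 p" using assms(3,4) by (simp add: ennreal_mult_divide_eq)
  thus "C1 p = K" using C1_is_least(2)[OF assms(1,2)] by (rule antisym[rotated])
  show "lp_norm p (discrete_deriv (maximal_fun (indicator S))) = K * ?b"
    using assms(2,4) ge unfolding C1_admissible_def by (blast intro: antisym)
qed

theorem theorem2p3:
  fixes p :: ennreal
  assumes "1 \<le> p"
  shows "(p < \<infinity> \<longrightarrow>
            C1 p = ennreal_powr
              (\<Sum>\<^sub>\<infinity>n\<in>{1::nat..}. ennreal ((1 / real n - 1 / real (n + 1)) powr enn2real p))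
              (1 / enn2real p)) \<and>
         (p = \<infinity> \<longrightarrow>
            C1 p = (SUP n\<in>{1::nat..}. ennreal (1 / real n - 1 / real (n + 1))) \<and>
            (SUP n\<in>{1::nat..}. ennreal (1 / real n - 1 / real (n + 1))) = 1 / 2) \<and>
         lp_norm p (discrete_deriv (maximal_fun (indicator {0})))
           = C1 p * lp_norm p (discrete_deriv (indicator {0}))"
proof (cases "p = \<infinity>")
  case True
  have norm: "lp_norm \<infinity> (discrete_deriv (indicator {0})) = 1"
  proof (rule antisym)
    show "lp_norm \<infinity> (discrete_deriv (indicator {0})) \<le> 1"
      by (auto simp: lp_norm_def discrete_deriv_def indicator_def intro!: SUP_least)
    show "1 \<le> lp_norm \<infinity> (discrete_deriv (indicator {0}))"
      by (auto simp: lp_norm_def discrete_deriv_def intro!: SUP_upper2[of 0])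
  qed
  \<comment> \<open>The step from 0 to 1, where the maximal function falls from 1 to
    \<open>1 / 2\<close>, already attains the bound.\<close>
  have half: "\<bar>discrete_deriv (maximal_fun (indicator {0})) 0\<bar> = 1 / 2"
    by (simp add: discrete_deriv_def maximal_indicator_zero)
  have "ennreal \<bar>discrete_deriv (maximal_fun (indicator {0})) 0\<bar>
      \<le> lp_norm \<infinity> (discrete_deriv (maximal_fun (indicator {0})))"
    by (auto simp: lp_norm_def intro: SUP_upper)
  hence "1 / 2 * lp_norm \<infinity> (discrete_deriv (indicator {0}))
      \<le> lp_norm \<infinity> (discrete_deriv (maximal_fun (indicator {0})))"
    unfolding half norm ennreal_half mult_1_right .
  moreover have "lp_norm \<infinity> (discrete_deriv (indicator {0})) \<noteq> 0"
    "lp_norm \<infinity> (discrete_deriv (indicator {0})) < \<infinity>"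
    unfolding norm by simp_all
  ultimately have "C1 \<infinity> = 1 / 2" "lp_norm \<infinity> (discrete_deriv (maximal_fun (indicator {0})))
      = 1 / 2 * lp_norm \<infinity> (discrete_deriv (indicator {0}))"
    using C1_eqI[OF _ C1_admissible_infinity, of "{0}"] top_greatest[of "1 :: ennreal"]
    unfolding infinity_ennreal_def by blast+
  thus ?thesis unfolding True by (simp only: SUP_inverse_differences) simp
next
  case False
  define q where "q = enn2real p"
  have q: "1 \<le> q"
    using enn2real_mono[OF assms] False by (simp add: q_def less_top)
  have norm: "lp_norm p f = ennreal_powr (\<Sum>\<^sub>\<infinity>n. ennreal (\<bar>f n\<bar> powr q)) (1 / q)" for f
    using False by (simp add: lp_norm_def q_def)
  define K where "K = ennreal_powr (extremal_sum q) (1 / q)"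
  have "C1_admissible p K"
    unfolding C1_admissible_def norm K_def ennreal_powr_mult[symmetric]
    using q by (auto intro: ennreal_powr_mono infsum_deriv_maximal_indicator_le)
  moreover have "lp_norm p (discrete_deriv (indicator {0})) = ennreal_powr 2 (1 / q)"
    by (simp add: norm infsum_deriv_indicator_zero)
  moreover have "lp_norm p (discrete_deriv (maximal_fun (indicator {0})))
      = K * ennreal_powr 2 (1 / q)"
    by (simp add: norm infsum_deriv_maximal_indicator_zero ennreal_powr_mult K_def)
  moreover have "ennreal_powr 2 (1 / q) \<noteq> 0" "ennreal_powr 2 (1 / q) < \<infinity>"
    by (simp_all add: ennreal_powr_def)
  ultimately have "C1 p = K" "lp_norm p (discrete_deriv (maximal_fun (indicator {0})))
      = K * lp_norm p (discrete_deriv (indicator {0}))"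
    using C1_eqI[OF assms, of K "{0}"] by simp_all
  thus ?thesis using False by (simp add: K_def extremal_sum_def q_def)
qed

end
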